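(* Let $\eta_n>0$ and let $a_n,b_n$ be nonnegative real numbers. For every $n\geq 1$, the infimal coverage probability of the interval $C_{S,n}=[\hat\theta_S-a_n,\hat\theta_S+b_n]$, where $p_{S,n}(\theta)=P_{n,\theta}(\theta\in C_{S,n})$, is given by $$\inf_{\theta\in\mathbb{R}}p_{S,n}(\theta)=\begin{cases}\Phi(n^{1/2}(a_n-\eta_n))-\Phi(n^{1/2}(-b_n-\eta_n)) & \text{if } a_n\leq b_n,\\ \Phi(n^{1/2}(b_n-\eta_n))-\Phi(n^{1/2}(-a_n-\eta_n)) & \text{if } a_n>b_n.\end{cases}$$
   Context: The data $y_1,\dots,y_n$ are i.i.d. $N(\theta,1)$ with $\theta\in\mathbb{R}$ unknown (variance known and equal to $1$); $P_{n,\theta}$ denotes the distribution of the sample when $\theta$ is the true parameter, and $\bar y=n^{-1}\sum_{i=1}^n y_i$. The tuning parameter $\eta_n$ is a positive real number. The soft-thresholding (LASSO) estimator is $\hat\theta_S=\operatorname{sign}(\bar y)(|\bar y|-\eta_n)_+$, where $z_+=\max\{z,0\}$ and $\operatorname{sign}(x)=-1,0,1$ for $x<0$, $x=0$, $x>0$ respectively. $\Phi$ is the standard normal cumulative distribution function. *)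

theory Defs
  imports "HOL-Probability.Probability"
begin

definition sample_dist :: "nat \<Rightarrow> real \<Rightarrow> (nat \<Rightarrow> real) measure" where
  "sample_dist n \<theta> = PiM {1..n} (\<lambda>i. density lborel (normal_density \<theta> 1))"

definition sample_mean :: "nat \<Rightarrow> (nat \<Rightarrow> real) \<Rightarrow> real" where
  "sample_mean n y = (\<Sum>i=1..n. y i) / real n"

definition soft_threshold_est :: "nat \<Rightarrow> real \<Rightarrow> (nat \<Rightarrow> real) \<Rightarrow> real" where
  "soft_threshold_est n \<eta> y = sgn (sample_mean n y) * max (\<bar>sample_mean n y\<bar> - \<eta>) 0"

definition soft_interval :: "nat \<Rightarrow> real \<Rightarrow> real \<Rightarrow> real \<Rightarrow> (nat \<Rightarrow> real) \<Rightarrow> real set" where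
  "soft_interval n \<eta> a b y = {soft_threshold_est n \<eta> y - a .. soft_threshold_est n \<eta> y + b}"

definition soft_coverage :: "nat \<Rightarrow> real \<Rightarrow> real \<Rightarrow> real \<Rightarrow> real \<Rightarrow> real" where
  "soft_coverage n \<eta> a b \<theta> =
     measure (sample_dist n \<theta>) {y \<in> space (sample_dist n \<theta>). \<theta> \<in> soft_interval n \<eta> a b y}"

definition std_normal_cdf :: "real \<Rightarrow> real" where
  "std_normal_cdf = cdf std_normal_distribution"

end

theory Submission
  imports Defs
begin

text \<open>
  Soft thresholding is a nondecreasing function of the sample mean, so the event that the interval
  covers \<open>\<theta>\<close> says that the sample mean lies in an interval. Its endpoints depend on the signs of
  \<open>\<theta> + a\<close> and \<open>\<theta> - b\<close> only through a shift by \<open>\<plusminus>\<eta>\<close>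
  (lemmas \<open>soft_threshold_le_iff\<close> and \<open>le_soft_threshold_iff\<close>). As \<open>sqrt n * (mean - \<theta>)\<close> is standard
  normal, the coverage probability is therefore piecewise constant in \<open>\<theta>\<close>, with at most three values
  (lemma \<open>soft_coverage_piecewise\<close>). With \<open>F x = \<Phi> (sqrt n * x)\<close> they are
  \<open>L = F (a - \<eta>) - F (- b - \<eta>)\<close> for \<open>\<theta> < - a\<close>,
  \<open>R = F (b - \<eta>) - F (- a - \<eta>)\<close> for \<open>\<theta> > b\<close>, and
  \<open>M = F (a + \<eta>) - F (- b - \<eta>)\<close> in between.

  The outer values \<open>L\<close> and \<open>R\<close> are always attained and \<open>M\<close> is at least as large as both, so the
  infimum is \<open>min L R\<close>. To see which one is smaller when \<open>a \<le> b\<close>, use the symmetry of \<open>\<Phi>\<close> to write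
  \<open>R - L\<close> as the normal mass of \<open>[a - \<eta>, b - \<eta>]\<close> minus that of \<open>[a + \<eta>, b + \<eta>]\<close>. Since \<open>a \<ge> 0\<close>,
  every point of the first interval is at least as close to the mode of the density as its translate
  by \<open>2 * \<eta>\<close>, so the difference is nonnegative (lemma \<open>std_normal_cdf_shift_le\<close>). The case \<open>a > b\<close>
  is the same with \<open>a\<close> and \<open>b\<close> exchanged.
\<close>

section \<open>The standard normal distribution function\<close>

lemma std_normal_cdf_uminus: "std_normal_cdf (- x) = 1 - std_normal_cdf x"
proof -
  interpret N: real_distribution std_normal_distribution by (rule real_dist_normal_dist)
  have "distributed std_normal_distribution lborel (\<lambda>y. 0 + (- 1) * y)
      (normal_density (0 + (- 1) * 0) (\<bar>- 1\<bar> * 1))"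
    by (rule N.normal_density_affine) (auto simp: distributed_def distr_id2)
  then have "distr std_normal_distribution lborel (\<lambda>y. - y) = std_normal_distribution"
    by (simp add: distributed_def)
  then have "std_normal_cdf (- x) =
      measure (distr std_normal_distribution lborel (\<lambda>y. - y)) {.. - x}"
    by (simp add: std_normal_cdf_def cdf_def)
  also have "\<dots> = measure std_normal_distribution {x..}"
    by (subst measure_distr)
      (auto simp: vimage_def intro!: arg_cong[where f="measure std_normal_distribution"])
  finally have reflect: "std_normal_cdf (- x) = measure std_normal_distribution {x..}" .
  have "measure std_normal_distribution ({x} \<union> {x<..}) =
      measure std_normal_distribution {x} + measure std_normal_distribution {x<..}"
    by (rule N.finite_measure_Union) auto
  moreover have "measure std_normal_distribution {x} = 0"
    by (simp add: measure_def emeasure_density)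
  moreover have "{x} \<union> {x<..} = {x..}" by auto
  moreover have "measure std_normal_distribution ({..x} \<union> {x<..}) =
      std_normal_cdf x + measure std_normal_distribution {x<..}"
    unfolding std_normal_cdf_def cdf_def by (rule N.finite_measure_Union) auto
  moreover have "{..x} \<union> {x<..} = space std_normal_distribution" by auto
  ultimately show ?thesis using reflect N.prob_space by simp
qed

lemma measure_std_normal_Icc:
  assumes "u \<le> v"
  shows "measure std_normal_distribution {u..v} = std_normal_cdf v - std_normal_cdf u"
proof -
  interpret N: real_distribution std_normal_distribution by (rule real_dist_normal_dist)
  have "measure std_normal_distribution {u} = 0"
    by (simp add: measure_def emeasure_density)
  moreover have "measure std_normal_distribution ({u} \<union> {u<..v}) =
      measure std_normal_distribution {u} + measure std_normal_distribution {u<..v}"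
    by (rule N.finite_measure_Union) auto
  moreover have "{u} \<union> {u<..v} = {u..v}" using assms by auto
  ultimately show ?thesis using assms N.cdf_diff_eq[of u v]
    by (cases "u = v") (auto simp: std_normal_cdf_def)
qed

text \<open>
  After translating both intervals back to \<open>[s, t]\<close>, the claim compares the densities at \<open>x + h\<close> and
  \<open>x - h\<close> pointwise; for \<open>x, h \<ge> 0\<close> the second point is at least as close to the mode.
\<close>

lemma std_normal_cdf_shift_le:
  assumes "0 \<le> h" "0 \<le> s" "s \<le> t"
  shows "std_normal_cdf (t + h) - std_normal_cdf (s + h)
    \<le> std_normal_cdf (t - h) - std_normal_cdf (s - h)"
proof -
  interpret N: real_distribution std_normal_distribution by (rule real_dist_normal_dist)
  have translate: "emeasure std_normal_distribution {s + c..t + c} =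
     (\<integral>\<^sup>+x. ennreal (std_normal_density (x + c)) * indicator {s..t} x \<partial>lborel)" for c
  proof -
    have "emeasure std_normal_distribution {s + c..t + c} =
        (\<integral>\<^sup>+x. ennreal (std_normal_density x) * indicator {s + c..t + c} x \<partial>lborel)"
      by (simp add: emeasure_density)
    also have "\<dots> = (\<integral>\<^sup>+x. ennreal (std_normal_density (x + c)) * indicator {s..t} x \<partial>lborel)"
      by (subst nn_integral_real_affine[where c=1 and t=c])
        (auto intro!: nn_integral_cong simp: indicator_def add.commute)
    finally show ?thesis .
  qed
  have "std_normal_density (x + h) \<le> std_normal_density (x + - h)" if "x \<in> {s..t}" for x
  proof -
    have "0 \<le> x * h" using that assms by auto
    then have "(x + - h)\<^sup>2 \<le> (x + h)\<^sup>2" by (simp add: power2_eq_square algebra_simps)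
    then show ?thesis by (simp add: std_normal_density_def divide_right_mono)
  qed
  then have "emeasure std_normal_distribution {s + h..t + h}
      \<le> emeasure std_normal_distribution {s + - h..t + - h}"
    unfolding translate by (intro nn_integral_mono) (auto simp: indicator_def intro!: ennreal_leI)
  then have "measure std_normal_distribution {s + h..t + h}
      \<le> measure std_normal_distribution {s + - h..t + - h}"
    by (simp add: N.emeasure_eq_measure)
  then show ?thesis using assms by (simp add: measure_std_normal_Icc)
qed

section \<open>The law of the sample mean\<close>

text \<open>
  Independence refers only to the \<open>\<sigma>\<close>-algebras of the target spaces. Separating the targets \<open>N\<close> from the
  factors \<open>M\<close> lets one treat the coordinates as \<open>borel\<close> variables although the factors are normal laws.
\<close>

lemma indep_vars_PiM_coordinates:
  assumes I: "I \<noteq> {}"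
    and prob: "\<And>i. i \<in> I \<Longrightarrow> prob_space (M i)"
    and sets: "\<And>i. i \<in> I \<Longrightarrow> sets (N i) = sets (M i)"
  shows "prob_space.indep_vars (PiM I M) N (\<lambda>i y. y i) I"
proof -
  interpret P: prob_space "PiM I M" by (rule prob_space_PiM) (rule prob)
  have marginal: "distr (PiM I M) (N i) (\<lambda>y. y i) = M i" if "i \<in> I" for i
  proof -
    have "distr (PiM I M) (N i) (\<lambda>y. y i) = distr (PiM I M) (M i) (\<lambda>y. y i)"
      by (intro distr_cong) (simp_all add: sets that)
    then show ?thesis using distr_PiM_component[of I M i] prob that by simp
  qed
  have "distr (PiM I M) (PiM I N) (\<lambda>y. \<lambda>i\<in>I. y i) = distr (PiM I M) (PiM I M) (\<lambda>y. y)"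
    by (intro distr_cong sets_PiM_cong) (auto simp: space_PiM sets PiE_restrict)
  also have "\<dots> = PiM I M" by (simp add: distr_id)
  also have "\<dots> = PiM I (\<lambda>i. distr (PiM I M) (N i) (\<lambda>y. y i))"
    by (intro PiM_cong) (simp_all add: marginal)
  finally have joint: "distr (PiM I M) (PiM I N) (\<lambda>y. \<lambda>i\<in>I. y i) =
      PiM I (\<lambda>i. distr (PiM I M) (N i) (\<lambda>y. y i))" .
  have measurable: "(\<lambda>y. y i) \<in> measurable (PiM I M) (N i)" if "i \<in> I" for i
    using measurable_component_singleton[OF that, of M]
      measurable_cong_sets[OF refl sets[OF that], of "PiM I M"] by simp
  show ?thesis
    using joint I measurable by (subst P.indep_vars_iff_distr_eq_PiM') auto
qed

lemma standardized_sample_mean_std_normal: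
  assumes "n \<ge> 1"
  shows "distributed (sample_dist n \<theta>) lborel (\<lambda>y. sqrt (real n) * (sample_mean n y - \<theta>))
    std_normal_density"
proof -
  define M where "M = (\<lambda>i::nat. density lborel (normal_density \<theta> 1))"
  have S: "sample_dist n \<theta> = PiM {1..n} M" by (simp add: sample_dist_def M_def)
  have prob: "prob_space (M i)" for i by (simp add: M_def prob_space_normal_density)
  interpret P: prob_space "PiM {1..n} M" by (rule prob_space_PiM) (rule prob)
  have indep: "P.indep_vars (\<lambda>i. borel) (\<lambda>i y. y i) {1..n}"
    by (rule indep_vars_PiM_coordinates) (use assms prob in \<open>auto simp: M_def\<close>)
  have "distributed (PiM {1..n} M) lborel (\<lambda>y. \<Sum>i\<in>{1..n}. y i)
     (normal_density (\<Sum>i\<in>{1..n}. \<theta>) (sqrt (\<Sum>i\<in>{1..n}. 1\<^sup>2)))"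
  proof (rule P.sum_indep_normal[OF _ _ indep])
    fix i assume i: "i \<in> {1..n}"
    have "distr (PiM {1..n} M) lborel (\<lambda>y. y i) = distr (PiM {1..n} M) (M i) (\<lambda>y. y i)"
      by (intro distr_cong) (auto simp: M_def)
    then have "distr (PiM {1..n} M) lborel (\<lambda>y. y i) = M i"
      using distr_PiM_component[of "{1..n}" M i] prob i by simp
    moreover have "(\<lambda>y. y i) \<in> borel_measurable (PiM {1..n} M)"
      using measurable_component_singleton[OF i, of M] by (simp add: M_def cong: measurable_cong_sets)
    ultimately show "distributed (PiM {1..n} M) lborel (\<lambda>y. y i) (normal_density \<theta> 1)"
      by (simp add: distributed_def M_def)
  qed (use assms in auto)
  then have "distributed (PiM {1..n} M) lborel
      (\<lambda>y. ((\<Sum>i\<in>{1..n}. y i) - real n * \<theta>) / sqrt (real n)) std_normal_density"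
    using assms by (subst (asm) P.normal_standard_normal_convert) auto
  moreover have "((\<Sum>i\<in>{1..n}. y i) - real n * \<theta>) / sqrt (real n) =
      sqrt (real n) * (sample_mean n y - \<theta>)" for y
    using assms by (simp add: sample_mean_def field_simps)
  ultimately show ?thesis by (simp add: S)
qed

lemma prob_sample_mean_between:
  assumes "n \<ge> 1" "l \<le> u"
  shows "measure (sample_dist n \<theta>)
      {y \<in> space (sample_dist n \<theta>). l \<le> sample_mean n y \<and> sample_mean n y \<le> u} =
    std_normal_cdf (sqrt (real n) * (u - \<theta>)) - std_normal_cdf (sqrt (real n) * (l - \<theta>))"
    (is "measure _ ?E = _")
proof -
  let ?Z = "\<lambda>y. sqrt (real n) * (sample_mean n y - \<theta>)"
  let ?I = "{sqrt (real n) * (l - \<theta>)..sqrt (real n) * (u - \<theta>)}"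
  have Z: "?Z \<in> borel_measurable (sample_dist n \<theta>)"
    "distr (sample_dist n \<theta>) lborel ?Z = std_normal_distribution"
    using standardized_sample_mean_std_normal[OF assms(1), of \<theta>] by (auto simp: distributed_def)
  have "?E = ?Z -` ?I \<inter> space (sample_dist n \<theta>)"
    using assms by auto
  then have "measure (sample_dist n \<theta>) ?E = measure std_normal_distribution ?I"
    unfolding Z(2)[symmetric] using Z(1) by (subst measure_distr) auto
  then show ?thesis using assms by (simp add: measure_std_normal_Icc mult_left_mono)
qed

section \<open>Coverage of the soft-thresholding interval\<close>

text \<open>
  Soft thresholding collapses \<open>[- \<eta>, \<eta>]\<close> to \<open>0\<close> and is a translation by \<open>\<eta>\<close> towards \<open>0\<close> outside. The
  preimage of a half-line thus ends at the translate of its endpoint \<open>c\<close> away from \<open>0\<close>; at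
  \<open>c = 0\<close> the whole collapsed interval belongs to the preimage, which is why the two lemmas treat
  \<open>c = 0\<close> differently.
\<close>

lemma soft_threshold_le_iff:
  fixes \<eta> x c :: real
  assumes "0 < \<eta>"
  shows "sgn x * max (\<bar>x\<bar> - \<eta>) 0 \<le> c \<longleftrightarrow> x \<le> c + (if 0 \<le> c then \<eta> else - \<eta>)"
  using assms by (auto simp: sgn_if max_def)

lemma le_soft_threshold_iff:
  fixes \<eta> x c :: real
  assumes "0 < \<eta>"
  shows "c \<le> sgn x * max (\<bar>x\<bar> - \<eta>) 0 \<longleftrightarrow> c + (if 0 < c then \<eta> else - \<eta>) \<le> x"
  using assms by (auto simp: sgn_if max_def)

text \<open>
  Covering \<open>\<theta>\<close> means that the estimate lies in \<open>[\<theta> - b, \<theta> + a]\<close>. Pulling this back to the sample mean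
  and subtracting \<open>\<theta>\<close> leaves endpoints that see \<open>\<theta>\<close> only through the signs of \<open>\<theta> - b\<close> and \<open>\<theta> + a\<close>.
  The symmetry of the normal law puts the value for \<open>b < \<theta>\<close> into the form of the value for
  \<open>\<theta> < - a\<close> with \<open>a\<close> and \<open>b\<close> exchanged.
\<close>

lemma soft_coverage_piecewise:
  assumes n: "n \<ge> 1" and \<eta>: "\<eta> > 0" and ab: "a \<ge> 0" "b \<ge> 0"
  defines "F \<equiv> (\<lambda>x. std_normal_cdf (sqrt (real n) * x))"
  shows "soft_coverage n \<eta> a b \<theta> =
     (if \<theta> < - a then F (a - \<eta>) - F (- b - \<eta>)
      else if b < \<theta> then F (b - \<eta>) - F (- a - \<eta>)
      else F (a + \<eta>) - F (- b - \<eta>))"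
proof -
  define l where "l = \<theta> - b + (if b < \<theta> then \<eta> else - \<eta>)"
  define u where "u = \<theta> + a + (if - a \<le> \<theta> then \<eta> else - \<eta>)"
  have "\<theta> \<in> soft_interval n \<eta> a b y \<longleftrightarrow> l \<le> sample_mean n y \<and> sample_mean n y \<le> u" for y
  proof -
    have "\<theta> \<in> soft_interval n \<eta> a b y \<longleftrightarrow>
      \<theta> - b \<le> soft_threshold_est n \<eta> y \<and> soft_threshold_est n \<eta> y \<le> \<theta> + a"
      by (auto simp: soft_interval_def)
    then show ?thesis
      using \<eta> by (simp add: soft_threshold_est_def soft_threshold_le_iff le_soft_threshold_iff
          l_def u_def)
  qed
  moreover have "l \<le> u" using \<eta> ab by (auto simp: l_def u_def)
  ultimately have coverage: "soft_coverage n \<eta> a b \<theta> = F (u - \<theta>) - F (l - \<theta>)"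
    using n by (simp add: soft_coverage_def prob_sample_mean_between F_def)
  have reflect: "F (- x) = 1 - F x" for x
    using std_normal_cdf_uminus[of "sqrt (real n) * x"] by (simp add: F_def)
  have right: "F (a + \<eta>) - F (\<eta> - b) = F (b - \<eta>) - F (- a - \<eta>)"
    using reflect[of "a + \<eta>"] reflect[of "b - \<eta>"] by simp
  consider "\<theta> < - a" | "b < \<theta>" | "- a \<le> \<theta>" "\<theta> \<le> b" by linarith
  then show ?thesis
  proof cases
    case 1
    then have "u - \<theta> = a - \<eta>" "l - \<theta> = - b - \<eta>" using ab by (auto simp: l_def u_def)
    then show ?thesis using 1 coverage by simp
  next
    case 2
    then have "u - \<theta> = a + \<eta>" "l - \<theta> = \<eta> - b" using ab by (auto simp: l_def u_def)
    then show ?thesis using 2 ab coverage right by simp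
  next
    case 3
    then have "u - \<theta> = a + \<eta>" "l - \<theta> = - b - \<eta>" by (auto simp: l_def u_def)
    then show ?thesis using 3 coverage by simp
  qed
qed

section \<open>The infimal coverage probability\<close>

theorem proposition1:
  fixes n :: nat and \<eta> a b :: real
  assumes "n \<ge> 1" and "\<eta> > 0" and "a \<ge> 0" and "b \<ge> 0"
  shows "(INF \<theta>. soft_coverage n \<eta> a b \<theta>) =
    (if a \<le> b
     then std_normal_cdf (sqrt (real n) * (a - \<eta>)) - std_normal_cdf (sqrt (real n) * (- b - \<eta>))
     else std_normal_cdf (sqrt (real n) * (b - \<eta>)) - std_normal_cdf (sqrt (real n) * (- a - \<eta>)))"
proof -
  define F where "F = (\<lambda>x. std_normal_cdf (sqrt (real n) * x))"
  define L where "L = F (a - \<eta>) - F (- b - \<eta>)"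
  define R where "R = F (b - \<eta>) - F (- a - \<eta>)"
  define M where "M = F (a + \<eta>) - F (- b - \<eta>)"
  have coverage:
    "soft_coverage n \<eta> a b \<theta> = (if \<theta> < - a then L else if b < \<theta> then R else M)" for \<theta>
    using soft_coverage_piecewise[OF assms] by (simp add: F_def L_def R_def M_def)
  interpret N: real_distribution std_normal_distribution by (rule real_dist_normal_dist)
  have mono: "F x \<le> F y" if "x \<le> y" for x y
    unfolding F_def std_normal_cdf_def using that
    by (intro N.cdf_nondecreasing mult_left_mono) auto
  have reflect: "F (- c - \<eta>) = 1 - F (c + \<eta>)" for c
    using std_normal_cdf_uminus[of "sqrt (real n) * (c + \<eta>)"]
    by (simp add: F_def flip: mult_minus_right)
  have shift: "F (t + \<eta>) - F (s + \<eta>) \<le> F (t - \<eta>) - F (s - \<eta>)" if "0 \<le> s" "s \<le> t" for s t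
    using std_normal_cdf_shift_le[of "sqrt (real n) * \<eta>" "sqrt (real n) * s" "sqrt (real n) * t"]
      that assms(2)
    by (simp add: F_def distrib_left right_diff_distrib mult_left_mono)
  have LM: "L \<le> M" and RM: "R \<le> M"
    using mono[of "a - \<eta>" "a + \<eta>"] mono[of "b - \<eta>" "b + \<eta>"] assms(2) reflect[of a] reflect[of b]
    by (simp_all add: L_def M_def R_def)
  have min: "(INF \<theta>. soft_coverage n \<eta> a b \<theta>) = min L R"
  proof (rule cInf_eq_minimum)
    have "soft_coverage n \<eta> a b (- a - 1) = L" "soft_coverage n \<eta> a b (b + 1) = R"
      using assms(3,4) by (simp_all add: coverage)
    then show "min L R \<in> range (soft_coverage n \<eta> a b)"
      unfolding min_def by (metis rangeI)
  qed (use LM RM in \<open>auto simp: coverage\<close>)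
  show ?thesis
  proof (cases "a \<le> b")
    case True
    then have "L \<le> R"
      using shift[of a b] assms(3) reflect[of a] reflect[of b] by (simp add: L_def R_def)
    then show ?thesis using True min by (simp add: L_def F_def)
  next
    case False
    then have "R \<le> L"
      using shift[of b a] assms(4) reflect[of a] reflect[of b] by (simp add: L_def R_def)
    then show ?thesis using False min by (simp add: R_def F_def)
  qed
qed

end
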